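(* There is a unimodular lattice $L$ in dimension $36$ having minimum norm $3$ with $\sigma(L)=20$.
   Context: A (Euclidean) lattice $L \subset \mathbb{R}^n$ in dimension $n$ (i.e. of full rank $n$) is unimodular if $L=L^*$, where $L^*=\{x\in\mathbb{R}^n \mid (x,y)\in\mathbb{Z}\text{ for all }y\in L\}$ and $(x,y)$ is the standard inner product. The norm of a vector $x$ is $(x,x)$ (the squared length), and the minimum norm $\min(L)$ is the smallest norm of a nonzero vector of $L$. A unimodular lattice is even if all its vectors have even norm, and odd otherwise; even unimodular lattices exist only in dimensions divisible by $8$, so a unimodular lattice in dimension $36$ is odd. For an odd unimodular lattice $L$, the even sublattice is $L_0=\{x\in L\mid (x,x)\in 2\mathbb{Z}\}$, the shadow is $S(L)=L_0^*\setminus L$, and $\sigma(L)=4\min(S(L))$, where $\min(S(L))$ is the minimum norm of a vector in $S(L)$. *)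

theory Defs
  imports "HOL-Analysis.Analysis"
begin

text \<open>Norms of vectors are squared lengths \<open>x \<bullet> x\<close> throughout, as is customary for lattices.\<close>

definition lattice_basis :: "'a::euclidean_space set \<Rightarrow> 'a set \<Rightarrow> bool" where
  "lattice_basis B L \<longleftrightarrow>
     independent B \<and> span B = UNIV \<and>
     L = {x. \<exists>c :: 'a \<Rightarrow> int. x = (\<Sum>b\<in>B. of_int (c b) *\<^sub>R b)}"

definition full_lattice :: "'a::euclidean_space set \<Rightarrow> bool" where
  "full_lattice L \<longleftrightarrow> (\<exists>B. lattice_basis B L)"

definition dual_lattice :: "'a::euclidean_space set \<Rightarrow> 'a set" where
  "dual_lattice L = {x. \<forall>y\<in>L. x \<bullet> y \<in> \<int>}"

definition unimodular :: "'a::euclidean_space set \<Rightarrow> bool" where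
  "unimodular L \<longleftrightarrow> full_lattice L \<and> L = dual_lattice L"

text \<open>The smallest norm occurring in a set of vectors; unspecified if no smallest one exists.\<close>

definition least_norm :: "'a::euclidean_space set \<Rightarrow> real" where
  "least_norm A = (LEAST m. \<exists>x\<in>A. m = x \<bullet> x)"

definition min_norm :: "'a::euclidean_space set \<Rightarrow> real" where
  "min_norm L = least_norm (L - {0})"

definition even_sublattice :: "'a::euclidean_space set \<Rightarrow> 'a set" where
  "even_sublattice L = {x \<in> L. \<exists>k::int. x \<bullet> x = 2 * of_int k}"

text \<open>The next two notions are meant for odd unimodular lattices. For even \<open>L = dual_lattice L\<close>
  the set \<open>shadow L\<close> would be empty.\<close>

definition shadow :: "'a::euclidean_space set \<Rightarrow> 'a set" where
  "shadow L = dual_lattice (even_sublattice L) - L"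

definition shadow_sigma :: "'a::euclidean_space set \<Rightarrow> real" where
  "shadow_sigma L = 4 * least_norm (shadow L)"

end

theory Submission
  imports Defs
begin

text \<open>
  Put the simple-root coordinates of the \<open>36\<close> positive roots of \<open>E\<^sub>6\<close> into the columns of a
  \<open>6 \<times> 36\<close> matrix. For all weights \<open>w, w'\<close>, the sum of \<open>(\<alpha>, w)(\<alpha>, w')\<close> over the positive
  roots is \<open>12 (w, w')\<close>. As \<open>3 (w, w')\<close> is an even integral form on the weight lattice, the rows
  have inner products divisible by \<open>4\<close> and norms divisible by \<open>8\<close>. Modulo \<open>2\<close> they span a
  \<open>[36, 6]\<close> code with nonzero weights \<open>16\<close> and \<open>20\<close>, since the roots modulo \<open>2\<close> are the points off
  an elliptic quadric. Construction A applied to the self-dual code over \<open>\<int>/4\<close> with this residue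
  code gives the lattice.

  Norms below \<open>4\<close> come only from the torsion code, whose minimum weight is \<open>3\<close> because the
  columns are nonzero and distinct modulo \<open>2\<close>. Twice a shadow vector is integral and congruent
  modulo \<open>2\<close> to the complement of a residue codeword, hence has at least \<open>36 - 20 = 16\<close> odd entries.
  The norm of this integral vector is \<open>4\<close> modulo \<open>8\<close>, hence at least \<open>20\<close>.
\<close>

section \<open>Full-rank subgroups commensurable with the integer lattice\<close>

lemma subgroup_int_scale:
  fixes L :: "'a::real_vector set"
  assumes "0 \<in> L" and diff: "\<And>x y. x \<in> L \<Longrightarrow> y \<in> L \<Longrightarrow> x - y \<in> L" and x: "x \<in> L"
  shows "of_int k *\<^sub>R x \<in> L"
proof -
  have minus: "- y \<in> L" if "y \<in> L" for y
    using diff[OF assms(1) that] by simp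
  have add: "y + z \<in> L" if "y \<in> L" "z \<in> L" for y z
    using diff[OF that(1) minus[OF that(2)]] by simp
  have nat: "of_nat n *\<^sub>R x \<in> L" for n
    by (induction n) (auto simp: assms(1) scaleR_left_distrib intro: add x)
  show ?thesis
  proof (cases "k \<ge> 0")
    case True
    then show ?thesis using nat[of "nat k"] by simp
  next
    case False
    then show ?thesis using minus[OF nat[of "nat (-k)"]] by simp
  qed
qed

text \<open>The coordinates are added one at a time. The new basis vector is one whose new coordinate is
  least positive.\<close>

lemma full_lattice_commensurable:
  fixes L :: "'a::euclidean_space set"
  assumes diff: "\<And>x y. x \<in> L \<Longrightarrow> y \<in> L \<Longrightarrow> x - y \<in> L"
    and c: "c \<noteq> 0"
    and cL: "\<And>b. b \<in> Basis \<Longrightarrow> c *\<^sub>R b \<in> L"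
    and Lc: "\<And>x b. x \<in> L \<Longrightarrow> b \<in> Basis \<Longrightarrow> c * (x \<bullet> b) \<in> \<int>"
  shows "full_lattice L"
proof -
  have zero: "0 \<in> L"
  proof -
    obtain b :: 'a where "b \<in> Basis" using nonempty_Basis by blast
    then show ?thesis using diff[OF cL cL, of b b] by simp
  qed
  note scale = subgroup_int_scale[OF zero diff]
  have add: "x + y \<in> L" if "x \<in> L" "y \<in> L" for x y
    using diff[OF that(1) diff[OF zero that(2)]] by simp
  define LS where "LS S = {x \<in> L. \<forall>b\<in>Basis - S. x \<bullet> b = 0}" for S :: "'a set"
  define gen where
    "gen B = {x. \<exists>k :: 'a \<Rightarrow> int. x = (\<Sum>b\<in>B. of_int (k b) *\<^sub>R b)}" for B :: "'a set"
  have "\<exists>B. finite B \<and> independent B \<and> LS S = gen B" if "finite S" "S \<subseteq> Basis" for S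
    using that
  proof (induction S rule: finite_induct)
    case empty
    have "LS {} = gen {}"
      using zero by (auto simp: LS_def gen_def euclidean_all_zero_iff)
    then show ?case by (intro exI[of _ "{}"]) (auto simp: independent_empty)
  next
    case (insert s S)
    then obtain B where B: "finite B" "independent B" "LS S = gen B" by auto
    have s: "s \<in> Basis" "s \<notin> S" using insert by auto
    define P where "P n \<longleftrightarrow> n > 0 \<and> (\<exists>x\<in>LS (insert s S). c * (x \<bullet> s) = real n)" for n :: nat
    have "\<exists>n. P n"
    proof -
      \<comment> \<open>\<open>c\<close> need not be an integer, but \<open>c * c\<close> is one,
        because the hypothesis \<open>Lc\<close> applies to \<open>c *\<^sub>R s\<close>
        itself.\<close>
      have "c * ((c *\<^sub>R s) \<bullet> s) \<in> \<int>" using Lc[OF cL] s by blast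
      then obtain m :: int where m: "c * ((c *\<^sub>R s) \<bullet> s) = of_int m" by (auto elim: Ints_cases)
      have sq: "c * c = of_int m" using m s by simp
      have "of_int m > (0::real)" using sq c by (metis mult_eq_0_iff not_square_less_zero not_less_iff_gr_or_eq)
      then have mp: "m > 0" by simp
      have "c *\<^sub>R s \<in> LS (insert s S)"
        using cL s by (auto simp: LS_def inner_Basis)
      then have "P (nat m)" unfolding P_def using m mp by (intro conjI bexI[of _ "c *\<^sub>R s"]) auto
      then show ?thesis ..
    qed
    define n where "n = (LEAST n. P n)"
    have Pn: "P n" and nmin: "\<And>k. P k \<Longrightarrow> n \<le> k"
      using \<open>\<exists>n. P n\<close> unfolding n_def by (auto intro: LeastI_ex Least_le)
    then obtain x0 where x0: "x0 \<in> LS (insert s S)" "c * (x0 \<bullet> s) = real n" "n > 0"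
      by (auto simp: P_def)
    have BLS: "b \<in> LS S" if "b \<in> B" for b
    proof -
      have "(\<Sum>b'\<in>B. of_int (if b' = b then 1 else 0) *\<^sub>R b') = (\<Sum>b'\<in>B. if b' = b then b' else 0)"
        by (rule sum.cong) auto
      also have "\<dots> = b" using that B(1) by simp
      finally have "b = (\<Sum>b'\<in>B. of_int (if b' = b then 1 else 0) *\<^sub>R b')" by simp
      then show ?thesis unfolding B(3) gen_def by (intro CollectI exI[of _ "\<lambda>b'. if b' = b then 1 else 0"])
    qed
    \<comment> \<open>The old basis lies in the hyperplane orthogonal to \<open>s\<close> and
      \<open>x0\<close> does not, so adjoining \<open>x0\<close> keeps independence.\<close>
    have "span B \<subseteq> {y. y \<bullet> s = 0}"
      using BLS s by (intro span_minimal subspaceI) (auto simp: LS_def inner_add_left)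
    moreover have "x0 \<bullet> s \<noteq> 0" using x0 by auto
    ultimately have x0B: "x0 \<notin> span B" by auto
    then have x0B': "x0 \<notin> B" using span_base by blast
    have "x \<in> gen (insert x0 B)" if x: "x \<in> LS (insert s S)" for x
    proof -
      have "c * (x \<bullet> s) \<in> \<int>" using x Lc s by (auto simp: LS_def)
      then obtain m :: int where m: "c * (x \<bullet> s) = of_int m" by (auto elim: Ints_cases)
      \<comment> \<open>Division with remainder by the least value \<open>n\<close>: a nonzero
        remainder would be a smaller positive value.\<close>
      define q r where "q = m div int n" and "r = m mod int n"
      have mqr: "m = q * int n + r" by (simp add: q_def r_def)
      define y where "y = x - of_int q *\<^sub>R x0"
      have y: "y \<in> LS (insert s S)"
        using x x0 unfolding LS_def y_def by (auto intro!: diff scale simp: inner_diff_left)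
      have ys: "c * (y \<bullet> s) = of_int r"
        using m x0(2) mqr by (simp add: y_def inner_diff_left algebra_simps)
      have "r = 0"
      proof (rule ccontr)
        assume "r \<noteq> 0"
        moreover have "0 \<le> r" "r < int n" using x0(3) unfolding r_def by simp_all
        ultimately have "r > 0" "r < int n" by simp_all
        then have "P (nat r)" unfolding P_def using y ys by (intro conjI bexI[of _ y]) auto
        from nmin[OF this] \<open>r < int n\<close> \<open>r > 0\<close> show False by linarith
      qed
      then have "y \<in> LS S" using y ys c by (auto simp: LS_def)
      then obtain k :: "'a \<Rightarrow> int" where k: "y = (\<Sum>b\<in>B. of_int (k b) *\<^sub>R b)"
        unfolding B(3) gen_def by blast
      have "x = of_int q *\<^sub>R x0 + y" by (simp add: y_def)
      also have "\<dots> = (\<Sum>b\<in>insert x0 B. of_int ((k(x0 := q)) b) *\<^sub>R b)"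
        using B(1) x0B' unfolding k by (auto intro!: sum.cong)
      finally show ?thesis unfolding gen_def by (intro CollectI exI[of _ "k(x0 := q)"])
    qed
    moreover have "x \<in> LS (insert s S)" if x: "x \<in> gen (insert x0 B)" for x
    proof -
      obtain k :: "'a \<Rightarrow> int" where k: "x = (\<Sum>b\<in>insert x0 B. of_int (k b) *\<^sub>R b)"
        using x unfolding gen_def by blast
      define y where "y = (\<Sum>b\<in>B. of_int (k b) *\<^sub>R b)"
      have "y \<in> LS S" unfolding B(3) gen_def y_def by blast
      moreover have "x = of_int (k x0) *\<^sub>R x0 + y" using k B(1) x0B' by (simp add: y_def)
      ultimately show ?thesis using x0(1) s
        by (auto simp: LS_def inner_add_left intro!: add scale)
    qed
    ultimately have "LS (insert s S) = gen (insert x0 B)" by blast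
    moreover have "independent (insert x0 B)" using B(2) x0B by (simp add: independent_insert)
    ultimately show ?case using B(1) by blast
  qed
  from this[OF finite_Basis order_refl] obtain B where
    B: "finite B" "independent B" "LS Basis = gen B" by blast
  have L: "L = gen B" using B(3) by (simp add: LS_def)
  have "L \<subseteq> span B" unfolding L gen_def by clarify (intro span_sum span_scale, rule span_base)
  then have "b \<in> span B" if "b \<in> Basis" for b
    using span_scale[of "c *\<^sub>R b" B "1/c"] cL[OF that] c by auto
  then have "span B = UNIV" using span_Basis span_minimal[of Basis "span B"] subspace_span by blast
  with B(2) L show ?thesis unfolding full_lattice_def lattice_basis_def gen_def by blast
qed

section \<open>The positive roots of \<open>E\<^sub>6\<close>\<close>

text \<open>Bourbaki numbering of the simple roots. The six simple roots come first, which makes the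
  matrix systematic.\<close>

definition E6_roots :: "int list list" where
  "E6_roots =
    [[1,0,0,0,0,0], [0,1,0,0,0,0], [0,0,1,0,0,0], [0,0,0,1,0,0], [0,0,0,0,1,0], [0,0,0,0,0,1],
     [1,0,1,0,0,0], [0,1,0,1,0,0], [0,0,1,1,0,0], [0,0,0,1,1,0], [0,0,0,0,1,1], [1,0,1,1,0,0],
     [0,1,1,1,0,0], [0,1,0,1,1,0], [0,0,1,1,1,0], [0,0,0,1,1,1], [1,1,1,1,0,0], [1,0,1,1,1,0],
     [0,1,1,1,1,0], [0,1,0,1,1,1], [0,0,1,1,1,1], [1,1,1,1,1,0], [1,0,1,1,1,1], [0,1,1,2,1,0],
     [0,1,1,1,1,1], [1,1,1,2,1,0], [1,1,1,1,1,1], [0,1,1,2,1,1], [1,1,2,2,1,0], [1,1,1,2,1,1],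
     [0,1,1,2,2,1], [1,1,2,2,1,1], [1,1,1,2,2,1], [1,1,2,2,2,1], [1,1,2,3,2,1], [1,2,2,3,2,1]]"

text \<open>A simple-root coordinate is the pairing with a fundamental weight, so the sum is 12
  times an entry of the inverse Cartan matrix. The denominators there divide 3, and 3 times a
  diagonal entry is even.\<close>

lemma E6_gram_table:
  "\<forall>i\<in>set [0..<6]. \<forall>k\<in>set [0..<6]. 4 dvd (\<Sum>r\<leftarrow>E6_roots. r ! i * r ! k) \<and>
     8 dvd (\<Sum>r\<leftarrow>E6_roots. r ! i * r ! i)"
  by code_simp

text \<open>Each of the 64 vectors \<open>c\<close> acts as pairing with a class of the root lattice
  modulo 2. The 36 classes of roots give weight 20, the other 27 nonzero classes weight 16.\<close>

lemma E6_weight_table: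
  "\<forall>c\<in>set (product_lists (replicate 6 [0, 1])). c = [0,0,0,0,0,0] \<or>
    length (filter (\<lambda>r. odd (\<Sum>i\<leftarrow>[0..<6]. c ! i * r ! i)) E6_roots) \<in> {16, 20}"
  by code_simp

lemma E6_distinct_table:
  "\<forall>m\<in>set [0..<36]. \<forall>n\<in>set [0..<m]. \<exists>i\<in>set [0..<6]. odd (E6_roots ! m ! i + E6_roots ! n ! i)"
  by code_simp

lemma E6_nonzero_table: "\<forall>m\<in>set [0..<36]. \<exists>i\<in>set [0..<6]. odd (E6_roots ! m ! i)"
  by code_simp

section \<open>The root matrix and its row combinations\<close>

definition pos36 :: "36 \<Rightarrow> nat" where
  "pos36 = (SOME f. bij_betw f UNIV {..<36})"

definition idx36 :: "nat \<Rightarrow> 36" where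
  "idx36 = inv_into UNIV pos36"

lemma bij_pos: "bij_betw pos36 UNIV {..<36}"
proof -
  have "\<exists>f :: 36 \<Rightarrow> nat. bij_betw f UNIV {..<36}"
    by (rule finite_same_card_bij) simp_all
  from someI_ex[OF this] show ?thesis by (simp add: pos36_def)
qed

lemma idx_pos [simp]: "idx36 (pos36 j) = j"
  using bij_pos by (simp add: idx36_def bij_betw_def)

lemma pos_idx: "n < 36 \<Longrightarrow> pos36 (idx36 n) = n"
  using bij_pos by (simp add: idx36_def bij_betw_def f_inv_into_f)

lemma pos_less: "pos36 j < 36"
  using bij_pos by (auto simp: bij_betw_def)

text \<open>The bijection \<open>pos36\<close> is arbitrary. Sums over the index type become list
  sums, to which the evaluated tables apply.\<close>

lemma sum_pos:
  fixes f :: "nat \<Rightarrow> 'b::comm_monoid_add"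
  shows "(\<Sum>j\<in>UNIV. f (pos36 j)) = (\<Sum>n\<leftarrow>[0..<36]. f n)"
proof -
  have "(\<Sum>j\<in>UNIV. f (pos36 j)) = sum f {..<36}"
    by (rule sum.reindex_bij_betw[OF bij_pos])
  also have "\<dots> = sum f (set [0..<36])" by (simp add: atLeast0LessThan)
  finally show ?thesis by (simp only: sum.distinct_set_conv_list[OF distinct_upt])
qed

lemma sum_six:
  fixes f :: "nat \<Rightarrow> 'b::comm_monoid_add"
  shows "(\<Sum>i<6. f i) = (\<Sum>i\<leftarrow>[0..<6]. f i)"
proof -
  have "(\<Sum>i<6. f i) = sum f (set [0..<6])" by (simp add: atLeast0LessThan)
  then show ?thesis by (simp only: sum.distinct_set_conv_list[OF distinct_upt])
qed

definition root_coeff :: "nat \<Rightarrow> 36 \<Rightarrow> int" where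
  "root_coeff i j = E6_roots ! pos36 j ! i"

definition root_comb :: "(nat \<Rightarrow> int) \<Rightarrow> 36 \<Rightarrow> int" where
  "root_comb a j = (\<Sum>i<6. a i * root_coeff i j)"

definition ip :: "(36 \<Rightarrow> int) \<Rightarrow> (36 \<Rightarrow> int) \<Rightarrow> int" where
  "ip u v = (\<Sum>j\<in>UNIV. u j * v j)"

lemma ip_commute: "ip u v = ip v u"
  by (simp add: ip_def mult.commute)

lemma ip_add_left: "ip (\<lambda>j. u j + v j) w = ip u w + ip v w"
  by (simp add: ip_def algebra_simps sum.distrib)

lemma ip_add_right: "ip w (\<lambda>j. u j + v j) = ip w u + ip w v"
  by (simp add: ip_def algebra_simps sum.distrib)

lemma ip_diff_left: "ip (\<lambda>j. u j - v j) w = ip u w - ip v w"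
  by (simp add: ip_def algebra_simps sum_subtractf)

lemma ip_diff_right: "ip w (\<lambda>j. u j - v j) = ip w u - ip w v"
  by (simp add: ip_def algebra_simps sum_subtractf)

lemma ip_scale_left: "ip (\<lambda>j. c * u j) w = c * ip u w"
  by (simp add: ip_def algebra_simps sum_distrib_left)

lemma ip_scale_right: "ip w (\<lambda>j. c * u j) = c * ip w u"
  by (simp add: ip_def algebra_simps sum_distrib_left)

lemmas ip_linear = ip_add_left ip_add_right ip_diff_left ip_diff_right ip_scale_left ip_scale_right

lemma ip_sum_right: "ip u (\<lambda>j. \<Sum>i\<in>I. f i j) = (\<Sum>i\<in>I. ip u (f i))"
  unfolding ip_def sum_distrib_left by (rule sum.swap)

lemma ip_root_comb: "ip u (root_comb a) = (\<Sum>i<6. a i * ip u (root_coeff i))"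
  by (simp add: root_comb_def[abs_def] ip_sum_right ip_scale_right)

lemma length_E6_roots [simp]: "length E6_roots = 36"
  by (simp add: E6_roots_def)

lemma ip_root_coeff: "ip (root_coeff i) (root_coeff k) = (\<Sum>r\<leftarrow>E6_roots. r ! i * r ! k)"
proof -
  have "ip (root_coeff i) (root_coeff k) = (\<Sum>n\<leftarrow>[0..<length E6_roots]. E6_roots ! n ! i * E6_roots ! n ! k)"
    unfolding ip_def root_coeff_def length_E6_roots by (rule sum_pos)
  also have "\<dots> = (\<Sum>r\<leftarrow>map (\<lambda>n. E6_roots ! n) [0..<length E6_roots]. r ! i * r ! k)"
    by (simp only: map_map comp_def)
  finally show ?thesis by (simp only: map_nth)
qed

lemma ip_root_coeff_dvd:
  assumes "i < 6" "k < 6"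
  shows "4 dvd ip (root_coeff i) (root_coeff k)" "8 dvd ip (root_coeff i) (root_coeff i)"
  using assms E6_gram_table by (auto simp: ip_root_coeff)

text \<open>In the norm of a combination each mixed inner product is divisible by 4 and enters
  twice, and the norms of the rows are divisible by 8. The induction adds one row at a time.\<close>

lemma ip_root_comb_dvd: "8 dvd ip (root_comb a) (root_comb a)"
proof -
  have "8 dvd ip (\<lambda>j. \<Sum>i<n. a i * root_coeff i j) (\<lambda>j. \<Sum>i<n. a i * root_coeff i j)" if "n \<le> 6" for n
    using that
  proof (induction n)
    case 0
    then show ?case by (simp add: ip_def)
  next
    case (Suc n)
    let ?p = "\<lambda>j. \<Sum>i<n. a i * root_coeff i j"
    have "ip ?p (root_coeff n) = (\<Sum>i<n. a i * ip (root_coeff i) (root_coeff n))"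
      by (simp add: ip_commute[of _ "root_coeff n"] ip_sum_right ip_scale_right)
    also have "4 dvd \<dots>" using Suc.prems by (intro dvd_sum dvd_mult ip_root_coeff_dvd(1)) auto
    finally have *: "4 dvd ip ?p (root_coeff n)" .
    have "8 dvd ip (root_coeff n) (root_coeff n)" using Suc.prems by (intro ip_root_coeff_dvd(2)[of n n]) auto
    moreover have "8 dvd ip ?p ?p" using Suc by simp
    moreover have "8 dvd 2 * a n * ip ?p (root_coeff n)"
    proof -
      obtain k where "ip ?p (root_coeff n) = 4 * k" using * by (rule dvdE)
      then have "2 * a n * ip ?p (root_coeff n) = 8 * (a n * k)" by simp
      then show ?thesis by (metis dvd_triv_left)
    qed
    moreover have "ip (\<lambda>j. \<Sum>i<Suc n. a i * root_coeff i j) (\<lambda>j. \<Sum>i<Suc n. a i * root_coeff i j)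
        = ip ?p ?p + 2 * a n * ip ?p (root_coeff n) + a n * a n * ip (root_coeff n) (root_coeff n)"
      by (simp add: ip_linear ip_commute[of "root_coeff n" ?p] algebra_simps)
    ultimately show ?case by simp
  qed
  from this[of 6] show ?thesis by (simp add: root_comb_def[abs_def])
qed

lemma card_eq_filter: "card {j::36. P (E6_roots ! pos36 j)} = length (filter P E6_roots)"
proof -
  have "card {j::36. P (E6_roots ! pos36 j)} = (\<Sum>j::36\<in>UNIV. if P (E6_roots ! pos36 j) then 1 else 0)"
    by (simp add: sum.If_cases)
  also have "\<dots> = (\<Sum>n\<leftarrow>[0..<length E6_roots]. if P (E6_roots ! n) then 1 else 0)"
    unfolding length_E6_roots by (rule sum_pos)
  also have "\<dots> = (\<Sum>r\<leftarrow>map (\<lambda>n. E6_roots ! n) [0..<length E6_roots]. if P r then 1 else 0)"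
    by (simp only: map_map comp_def)
  also have "\<dots> = (\<Sum>r\<leftarrow>E6_roots. if P r then 1 else 0)" by (simp only: map_nth)
  also have "\<dots> = length (filter P E6_roots)"
    by (simp add: sum_list_map_filter'[symmetric] sum_list_triv)
  finally show ?thesis .
qed

text \<open>Parities of entries depend on the coefficients only modulo 2, which leaves the cases of
  \<open>E6_weight_table\<close>. The first alternative is the zero word.\<close>

lemma weight_root_comb:
  "(\<forall>i<6. even (a i)) \<or> card {j. odd (root_comb a j)} = 16 \<or> card {j. odd (root_comb a j)} = 20"
proof -
  define c where "c = map (\<lambda>i. a i mod 2) [0..<6]"
  have "c \<in> set (product_lists (replicate 6 [0, 1]))"
    by (auto simp: c_def product_lists_set list_all2_conv_all_nth)
  moreover have "odd (root_comb a j) \<longleftrightarrow> odd (\<Sum>i\<leftarrow>[0..<6]. c ! i * E6_roots ! pos36 j ! i)" for j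
  proof -
    have "even (root_comb a j - (\<Sum>i<6. c ! i * E6_roots ! pos36 j ! i))"
      unfolding root_comb_def root_coeff_def sum_subtractf[symmetric] left_diff_distrib[symmetric]
      by (intro dvd_sum dvd_mult2) (simp add: c_def minus_mod_eq_mult_div)
    then show ?thesis unfolding sum_six by simp
  qed
  then have "card {j. odd (root_comb a j)}
      = length (filter (\<lambda>r. odd (\<Sum>i\<leftarrow>[0..<6]. c ! i * r ! i)) E6_roots)"
    by (simp only: card_eq_filter[of "\<lambda>r. odd (\<Sum>i\<leftarrow>[0..<6]. c ! i * r ! i)"])
  moreover have "\<forall>i<6. even (a i)" if "c = [0,0,0,0,0,0]"
  proof (intro allI impI)
    fix i :: nat assume "i < 6"
    then have "c ! i = a i mod 2" by (simp add: c_def)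
    moreover have "c ! i = 0" using \<open>i < 6\<close> that by (auto simp: less_Suc_eq numeral_eq_Suc)
    ultimately show "even (a i)" by presburger
  qed
  ultimately show ?thesis using E6_weight_table by fastforce
qed

text \<open>The table covers only pairs with the larger position first; symmetry in \<open>j\<close>
  and \<open>k\<close> supplies the others.\<close>

lemma root_coeff_separates: "j \<noteq> k \<Longrightarrow> \<exists>i<6. odd (root_coeff i j + root_coeff i k)"
proof (induction "pos36 j" "pos36 k" arbitrary: j k rule: linorder_wlog)
  case le
  then have "pos36 j < pos36 k" using idx_pos[of j] idx_pos[of k] by (metis le_neq_implies_less)
  then show ?case using E6_distinct_table pos_less[of j] pos_less[of k]
    by (fastforce simp: root_coeff_def add.commute)
next
  case sym
  then show ?case by (metis add.commute)
qed

lemma root_coeff_nonzero: "\<exists>i<6. odd (root_coeff i j)"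
  using E6_nonzero_table pos_less[of j] by (fastforce simp: root_coeff_def)

text \<open>This identity block lets the coefficients of a row combination be read off from the
  first six positions.\<close>

lemma root_coeff_simple: "i < 6 \<Longrightarrow> k < 6 \<Longrightarrow> root_coeff i (idx36 k) = (if i = k then 1 else 0)"
proof -
  have "\<forall>i\<in>set [0..<6]. \<forall>k\<in>set [0..<6]. E6_roots ! k ! i = (if i = k then 1 else 0)"
    by code_simp
  then show "i < 6 \<Longrightarrow> k < 6 \<Longrightarrow> root_coeff i (idx36 k) = (if i = k then 1 else 0)"
    by (simp add: root_coeff_def pos_idx)
qed

section \<open>The binary torsion code and the quaternary code\<close>

definition unit_word :: "36 \<Rightarrow> 36 \<Rightarrow> int" where
  "unit_word j k = (if k = j then 1 else 0)"

lemma ip_unit_word [simp]: "ip u (unit_word j) = u j" "ip (unit_word j) u = u j"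
  by (simp_all add: ip_def unit_word_def if_distrib if_distribR cong: if_cong)

lemma four_dvd_double: "4 dvd 2 * m \<longleftrightarrow> even m" for m :: int
  by presburger

text \<open>Codes are given by all their integral representatives, so that the lattice is the set of
  halves of the words of \<open>quaternary_code\<close>.\<close>

definition torsion_code :: "(36 \<Rightarrow> int) set" where
  "torsion_code = {z. \<forall>i<6. even (ip z (root_coeff i))}"

definition quaternary_code :: "(36 \<Rightarrow> int) set" where
  "quaternary_code = {u. (\<exists>a. \<forall>j. even (u j - root_comb a j)) \<and> (\<forall>i<6. 4 dvd ip u (root_coeff i))}"

lemma torsion_code_root_comb: "z \<in> torsion_code \<Longrightarrow> even (ip z (root_comb a))"
  unfolding ip_root_comb by (intro dvd_sum dvd_mult) (simp add: torsion_code_def)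

lemma quaternary_code_root_comb: "u \<in> quaternary_code \<Longrightarrow> 4 dvd ip u (root_comb a)"
  unfolding ip_root_comb by (intro dvd_sum dvd_mult) (simp add: quaternary_code_def)

lemma root_comb_dvd: "i < 6 \<Longrightarrow> 4 dvd ip (root_comb a) (root_coeff i)"
  unfolding ip_commute[of "root_comb a"] ip_root_comb by (intro dvd_sum dvd_mult ip_root_coeff_dvd(1)) auto

lemma root_comb_diff: "root_comb a j - root_comb b j = root_comb (\<lambda>i. a i - b i) j"
  by (simp add: root_comb_def algebra_simps sum_subtractf)

lemma root_comb_zero [simp]: "root_comb (\<lambda>i. 0) j = 0"
  by (simp add: root_comb_def)

lemma root_comb_single: "k < 6 \<Longrightarrow> root_comb (\<lambda>i. if i = k then 1 else 0) = root_coeff k"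
  by (simp add: root_comb_def fun_eq_iff if_distrib if_distribR cong: if_cong)

text \<open>Subtracting a row combination with the same residue leaves twice a word
  \<open>z\<close>. Rows are orthogonal modulo 4, so the condition modulo 4 on \<open>u\<close>
  becomes a parity condition on \<open>z\<close>.\<close>

lemma quaternary_code_decompose:
  assumes "u \<in> quaternary_code"
  obtains a z where "u = (\<lambda>j. root_comb a j + 2 * z j)" "z \<in> torsion_code"
proof -
  obtain a where a: "\<And>j. even (u j - root_comb a j)" using assms by (auto simp: quaternary_code_def)
  define z where "z j = (u j - root_comb a j) div 2" for j
  have u: "u = (\<lambda>j. root_comb a j + 2 * z j)" using a by (auto simp: z_def)
  have "even (ip z (root_coeff i))" if "i < 6" for i
  proof -
    have "4 dvd ip u (root_coeff i)" using assms that by (simp add: quaternary_code_def)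
    moreover have "ip u (root_coeff i) = ip (root_comb a) (root_coeff i) + 2 * ip z (root_coeff i)" by (simp add: u ip_linear)
    ultimately show ?thesis using root_comb_dvd[OF that, of a] by presburger
  qed
  then show ?thesis using that u by (simp add: torsion_code_def)
qed

text \<open>Only the term between the residue part of \<open>u\<close> and the doubled part of
  \<open>v\<close> needs care; it is twice an even number because torsion words are orthogonal to
  rows modulo 2.\<close>

lemma quaternary_code_integral:
  assumes "u \<in> quaternary_code" "v \<in> quaternary_code"
  shows "4 dvd ip u v"
proof -
  obtain a z where u: "u = (\<lambda>j. root_comb a j + 2 * z j)" "z \<in> torsion_code" by (rule quaternary_code_decompose[OF assms(1)])
  obtain b y where v: "v = (\<lambda>j. root_comb b j + 2 * y j)" "y \<in> torsion_code" by (rule quaternary_code_decompose[OF assms(2)])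
  have "ip u v = ip u (root_comb b) + 2 * ip (root_comb a) y + 4 * ip z y"
    by (simp add: u v ip_linear)
  moreover have "even (ip (root_comb a) y)" using torsion_code_root_comb[OF v(2)] by (simp add: ip_commute)
  ultimately show ?thesis using quaternary_code_root_comb[OF assms(1), of b] by presburger
qed

lemma quaternary_code_diff:
  assumes "u \<in> quaternary_code" "v \<in> quaternary_code"
  shows "(\<lambda>j. u j - v j) \<in> quaternary_code"
proof -
  obtain a where a: "\<And>j. even (u j - root_comb a j)" using assms by (auto simp: quaternary_code_def)
  obtain b where b: "\<And>j. even (v j - root_comb b j)" using assms by (auto simp: quaternary_code_def)
  have "even ((u j - v j) - root_comb (\<lambda>i. a i - b i) j)" for j
    using a[of j] b[of j] unfolding root_comb_diff[symmetric] by presburger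
  then show ?thesis using assms by (auto simp: quaternary_code_def ip_linear intro!: exI[of _ "\<lambda>i. a i - b i"])
qed

lemma two_torsion_code: "z \<in> torsion_code \<Longrightarrow> (\<lambda>j. 2 * z j) \<in> quaternary_code"
  by (auto simp: quaternary_code_def torsion_code_def ip_linear four_dvd_double intro!: exI[of _ "\<lambda>i. 0"])

lemma two_unit_torsion_code: "(\<lambda>k. 2 * unit_word j k) \<in> torsion_code"
  by (simp add: torsion_code_def ip_linear)

lemma root_coeff_quaternary_code: "i < 6 \<Longrightarrow> root_coeff i \<in> quaternary_code"
  using root_comb_single[of i] ip_root_coeff_dvd(1)
  by (auto simp: quaternary_code_def intro!: exI[of _ "\<lambda>k. if k = i then 1 else 0"])

text \<open>Biduality modulo 2: the torsion code is the dual of the residue code. The coefficients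
  are the entries of \<open>u\<close> at the simple roots.\<close>

lemma torsion_code_dual:
  assumes "\<And>z. z \<in> torsion_code \<Longrightarrow> even (ip u z)"
  shows "\<exists>a. \<forall>j. even (u j - root_comb a j)"
proof (intro exI allI)
  fix j
  \<comment> \<open>The relation expressing the \<open>j\<close>-th root in the simple roots is a torsion word.\<close>
  define z where "z k = unit_word j k - (\<Sum>i<6. root_coeff i j * unit_word (idx36 i) k)" for k
  have ip_z: "ip v z = v j - (\<Sum>i<6. root_coeff i j * v (idx36 i))" for v
    by (simp add: z_def[abs_def] ip_diff_right ip_sum_right ip_scale_right)
  have "ip z (root_coeff i) = 0" if "i < 6" for i
    unfolding ip_commute[of z] ip_z using that
    by (simp add: root_coeff_simple if_distrib if_distribR cong: if_cong)
  then have "z \<in> torsion_code" by (simp add: torsion_code_def)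
  from assms[OF this] show "even (u j - root_comb (\<lambda>i. u (idx36 i)) j)"
    by (simp add: ip_z root_comb_def mult.commute)
qed

text \<open>Modulo 8 the row combination and the cross term vanish, which leaves
  \<open>4 * ip z z\<close>.\<close>

lemma quaternary_code_norm_mod_8:
  assumes "z \<in> torsion_code"
  shows "8 dvd ip (\<lambda>j. root_comb a j + 2 * z j) (\<lambda>j. root_comb a j + 2 * z j) \<longleftrightarrow> even (ip z z)"
proof -
  have "ip (\<lambda>j. root_comb a j + 2 * z j) (\<lambda>j. root_comb a j + 2 * z j)
      = ip (root_comb a) (root_comb a) + 4 * ip z (root_comb a) + 4 * ip z z"
    by (simp add: ip_linear ip_commute[of "root_comb a" z])
  then show ?thesis using ip_root_comb_dvd[of a] torsion_code_root_comb[OF assms, of a] by presburger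
qed

text \<open>Squaring preserves parity, so the norm modulo 2 is linear: it is the pairing with the
  all-one word.\<close>

lemma even_ip_one: "even (ip (\<lambda>j. 1) z - ip z z)"
proof -
  have "ip (\<lambda>j. 1) z - ip z z = (\<Sum>j\<in>UNIV. z j * (1 - z j))"
    by (simp add: ip_def sum_subtractf[symmetric] algebra_simps)
  also have "even \<dots>" by (intro dvd_sum) auto
  finally show ?thesis .
qed

section \<open>Even words and shadow words\<close>

definition even_words where "even_words = {u \<in> quaternary_code. 8 dvd ip u u}"

text \<open>The condition modulo 4 is that of \<open>quaternary_code\<close>, but the residue lies
  in the coset of the residue code through the all-one word.\<close>

definition shadow_words :: "(36 \<Rightarrow> int) set" where
  "shadow_words = {v. (\<exists>a. \<forall>j. even (v j - 1 - root_comb a j)) \<and> (\<forall>i<6. 4 dvd ip v (root_coeff i))}"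

text \<open>The all-one word has weight 36, which is not a weight of the residue code. Hence its
  coset is disjoint from the code.\<close>

lemma not_all_odd: "\<exists>j. even (root_comb a j)"
proof (rule ccontr)
  assume *: "\<not> ?thesis"
  then have "{j. odd (root_comb a j)} = UNIV" by auto
  then have "card {j. odd (root_comb a j)} = 36" by simp
  with weight_root_comb[of a] have "\<forall>i<6. even (a i)" by auto
  then have "even (root_comb a j)" for j unfolding root_comb_def by (intro dvd_sum dvd_mult2) auto
  with * show False by blast
qed

lemma shadow_words_not_quaternary_code: "v \<in> shadow_words \<Longrightarrow> v \<notin> quaternary_code"
proof
  assume "v \<in> shadow_words" "v \<in> quaternary_code"
  obtain a where a: "\<And>j. even (v j - 1 - root_comb a j)" using \<open>v \<in> shadow_words\<close> by (auto simp: shadow_words_def)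
  obtain b where b: "\<And>j. even (v j - root_comb b j)" using \<open>v \<in> quaternary_code\<close> by (auto simp: quaternary_code_def)
  have "odd (root_comb (\<lambda>i. b i - a i) j)" for j
    using a[of j] b[of j] unfolding root_comb_diff[symmetric] by presburger
  with not_all_odd show False by blast
qed

text \<open>Modulo 2, \<open>v\<close> is the all-one word plus a residue word. The torsion part of
  an even word is orthogonal to both, to the first because its norm is even.\<close>

lemma shadow_words_integral:
  assumes "v \<in> shadow_words" "u \<in> even_words"
  shows "4 dvd ip v u"
proof -
  have "u \<in> quaternary_code" using assms(2) by (simp add: even_words_def)
  then obtain b z where u: "u = (\<lambda>j. root_comb b j + 2 * z j)" "z \<in> torsion_code" by (rule quaternary_code_decompose)
  have z: "even (ip z z)" using assms(2) quaternary_code_norm_mod_8[OF u(2), of b] by (simp add: even_words_def u(1))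
  obtain a where a: "\<And>j. even (v j - 1 - root_comb a j)" using assms(1) by (auto simp: shadow_words_def)
  have "4 dvd ip v (root_comb b)" unfolding ip_root_comb
    using assms(1) by (intro dvd_sum dvd_mult) (simp add: shadow_words_def)
  moreover have "even (ip v z)"
  proof -
    have "even (ip (\<lambda>j. v j - 1 - root_comb a j) z)"
      unfolding ip_def using a by (intro dvd_sum dvd_mult2) auto
    moreover have "ip (\<lambda>j. v j - 1 - root_comb a j) z = ip v z - ip (\<lambda>j. 1) z - ip z (root_comb a)"
      by (simp add: ip_diff_left ip_commute[of z])
    ultimately show ?thesis using torsion_code_root_comb[OF u(2), of a] z even_ip_one[of z] by presburger
  qed
  moreover have "ip v u = ip v (root_comb b) + 2 * ip v z" by (simp add: u ip_linear)
  ultimately show ?thesis by presburger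
qed

text \<open>On torsion words, pairing with \<open>v\<close> modulo 2 vanishes on those of even norm.
  So it is either zero or the parity of the norm, that is, pairing with the all-one word; by
  \<open>torsion_code_dual\<close>, \<open>v\<close> or \<open>v\<close> minus the all-one word has
  its residue in the code.\<close>

lemma even_words_dual:
  assumes "\<And>u. u \<in> even_words \<Longrightarrow> 4 dvd ip v u"
  shows "v \<in> quaternary_code \<or> v \<in> shadow_words"
proof -
  have v_g: "4 dvd ip v (root_coeff i)" if "i < 6" for i
    using assms[of "root_coeff i"] that root_coeff_quaternary_code ip_root_coeff_dvd(2)[OF that that] by (simp add: even_words_def)
  have v_z: "even (ip v z)" if "z \<in> torsion_code" "even (ip z z)" for z
  proof -
    have "(\<lambda>j. 2 * z j) \<in> even_words" using that two_torsion_code by (auto simp: even_words_def ip_linear)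
    from assms[OF this] show ?thesis by (simp add: ip_linear four_dvd_double)
  qed
  \<comment> \<open>Two torsion words of odd norm differ by one of even norm, since the mixed term
    is doubled.\<close>
  have diff: "even (ip v z - ip v y)" if "z \<in> torsion_code" "y \<in> torsion_code" "odd (ip z z)" "odd (ip y y)" for z y
  proof -
    have "(\<lambda>j. z j - y j) \<in> torsion_code" using that by (auto simp: torsion_code_def ip_linear)
    moreover have "even (ip (\<lambda>j. z j - y j) (\<lambda>j. z j - y j))"
      using that by (simp add: ip_linear ip_commute[of y z])
    ultimately show ?thesis using v_z[of "\<lambda>j. z j - y j"] by (simp add: ip_diff_right)
  qed
  show ?thesis
  proof (cases "\<exists>y\<in>torsion_code. odd (ip y y) \<and> odd (ip v y)")
    case True
    then obtain y where y: "y \<in> torsion_code" "odd (ip y y)" "odd (ip v y)" by blast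
    have "even (ip (\<lambda>j. v j - 1) z)" if "z \<in> torsion_code" for z
      using v_z[OF that] diff[OF that y(1)] y even_ip_one[of z]
      unfolding ip_diff_left by presburger
    then have "\<exists>a. \<forall>j. even (v j - 1 - root_comb a j)" by (rule torsion_code_dual)
    then have "v \<in> shadow_words" using v_g by (auto simp: shadow_words_def)
    then show ?thesis ..
  next
    case False
    then have "even (ip v z)" if "z \<in> torsion_code" for z using v_z[OF that] that by blast
    then have "\<exists>a. \<forall>j. even (v j - root_comb a j)" by (rule torsion_code_dual)
    then have "v \<in> quaternary_code" using v_g by (auto simp: quaternary_code_def)
    then show ?thesis ..
  qed
qed

text \<open>Testing against doubled torsion words gives the residue condition, testing against the
  rows the condition modulo 4.\<close>

lemma quaternary_code_dual:
  assumes "\<And>u. u \<in> quaternary_code \<Longrightarrow> 4 dvd ip v u"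
  shows "v \<in> quaternary_code"
proof -
  have "even (ip v z)" if "z \<in> torsion_code" for z
    using assms[OF two_torsion_code[OF that]] by (simp add: ip_linear four_dvd_double)
  then have "\<exists>a. \<forall>j. even (v j - root_comb a j)" by (rule torsion_code_dual)
  then show ?thesis using assms[OF root_coeff_quaternary_code] by (auto simp: quaternary_code_def)
qed

section \<open>Lower bounds for norms\<close>

lemma card_odd_le_norm: "int (card {j. odd (v j)}) \<le> ip v v"
proof -
  have "int (card {j. odd (v j)}) = (\<Sum>j\<in>UNIV. if odd (v j) then 1 else 0)"
    by (simp add: sum.If_cases)
  also have "\<dots> \<le> ip v v" unfolding ip_def
  proof (rule sum_mono)
    fix j
    show "(if odd (v j) then 1 else 0) \<le> v j * v j"
      using zero_le_square[of "v j"] by (cases "v j = 0") (auto simp: less_le int_one_le_iff_zero_less)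
  qed
  finally show ?thesis .
qed

text \<open>Removing a row combination leaves 36 odd entries with squares 1 modulo 8, and 36 is 4
  modulo 8. The correction terms are divisible by 8.\<close>

lemma shadow_words_norm_mod_8:
  assumes "v \<in> shadow_words"
  shows "ip v v mod 8 = 4"
proof -
  obtain a where a: "\<And>j. even (v j - 1 - root_comb a j)" using assms(1) by (auto simp: shadow_words_def)
  define w where "w j = v j - root_comb a j" for j
  have "8 dvd w j * w j - 1" for j
  proof -
    obtain k where "w j = 2 * k + 1" using a[of j] unfolding w_def by (elim evenE) (smt (verit))
    then have "w j * w j - 1 = 4 * (k * (k + 1))" by (simp add: algebra_simps)
    moreover have "even (k * (k + 1))" by simp
    then obtain m where "k * (k + 1) = 2 * m" by (rule evenE)
    ultimately show ?thesis by simp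
  qed
  then have "8 dvd (\<Sum>j\<in>UNIV. w j * w j - 1)" by (intro dvd_sum) auto
  then have "8 dvd ip w w - 36" by (simp add: ip_def sum_subtractf)
  moreover have "ip w w = ip v v - 2 * ip v (root_comb a) + ip (root_comb a) (root_comb a)"
    by (simp add: w_def[abs_def] ip_linear ip_commute algebra_simps)
  moreover have "4 dvd ip v (root_comb a)" unfolding ip_root_comb
    using assms(1) by (intro dvd_sum dvd_mult) (simp add: shadow_words_def)
  ultimately show ?thesis using ip_root_comb_dvd[of a] by presburger
qed

lemma shadow_words_norm:
  assumes "v \<in> shadow_words"
  shows "20 \<le> ip v v"
proof -
  obtain a where a: "\<And>j. even (v j - 1 - root_comb a j)" using assms(1) by (auto simp: shadow_words_def)
  have "odd (v j) \<longleftrightarrow> even (root_comb a j)" for j using a[of j] by presburger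
  then have *: "{j. odd (v j)} = - {j. odd (root_comb a j)}" by auto
  have "card {j. odd (root_comb a j)} \<le> 20"
  proof -
    have "card {j. odd (root_comb a j)} = 0" if "\<forall>i<6. even (a i)"
    proof -
      have "even (root_comb a j)" for j unfolding root_comb_def using that by (intro dvd_sum dvd_mult2) auto
      then show ?thesis by simp
    qed
    then show ?thesis using weight_root_comb[of a] by auto
  qed
  then have "card {j. odd (v j)} \<ge> 16" unfolding * by (simp add: Compl_eq_Diff_UNIV card_Diff_subset)
  then have "16 \<le> ip v v" using card_odd_le_norm[of v] by linarith
  \<comment> \<open>The least number from 16 on that is 4 modulo 8 is 20.\<close>
  then show ?thesis using shadow_words_norm_mod_8[OF assms] by presburger
qed

text \<open>A nonzero residue gives at least 16 odd entries. Otherwise the word is twice a torsion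
  word, and norm below 3 would mean one or two odd entries, hence a zero column or two equal columns
  modulo 2.\<close>

lemma quaternary_code_norm:
  assumes "u \<in> quaternary_code" "u \<noteq> (\<lambda>j. 0)"
  shows "12 \<le> ip u u"
proof -
  obtain a where a: "\<And>j. even (u j - root_comb a j)" using assms(1) by (auto simp: quaternary_code_def)
  have odd_iff: "odd (u j) \<longleftrightarrow> odd (root_comb a j)" for j using a[of j] by simp
  show ?thesis
  proof (cases "\<forall>i<6. even (a i)")
    case False
    then have "card {j. odd (u j)} \<ge> 16" unfolding odd_iff using weight_root_comb[of a] by auto
    then show ?thesis using card_odd_le_norm[of u] by linarith
  next
    case True
    then have "even (root_comb a j)" for j unfolding root_comb_def by (intro dvd_sum dvd_mult2) auto
    then have ev: "even (u j)" for j using odd_iff by blast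
    define z where "z j = u j div 2" for j
    have u: "u = (\<lambda>j. 2 * z j)" using ev by (auto simp: z_def)
    have z: "even (ip z (root_coeff i))" if "i < 6" for i
      using assms(1) that by (simp add: quaternary_code_def u ip_linear four_dvd_double)
    have uz: "ip u u = 4 * ip z z" by (simp add: u ip_linear)
    show ?thesis
    proof (rule ccontr)
      assume "\<not> ?thesis"
      then have small: "ip z z < 3" by (simp add: uz)
      \<comment> \<open>With a single position this forces nonzero entries to be odd; with three
        positions it bounds the support by two.\<close>
      have part: "(\<Sum>j\<in>T. z j * z j) < 3" for T
      proof -
        have "(\<Sum>j\<in>T. z j * z j) \<le> ip z z" unfolding ip_def by (intro sum_mono2) auto
        then show ?thesis using small by simp
      qed
      have "\<exists>j. z j \<noteq> 0"
      proof (rule ccontr)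
        assume "\<not> ?thesis"
        then have "u = (\<lambda>j. 0)" by (simp add: u)
        with assms(2) show False ..
      qed
      then obtain j where j: "z j \<noteq> 0" ..
      have sq: "1 \<le> m * m" if "m \<noteq> 0" for m :: int
        using zero_less_power2[of m] that by (simp add: power2_eq_square int_one_le_iff_zero_less)
      have oddz: "odd (z k)" if "z k \<noteq> 0" for k
      proof
        assume "even (z k)"
        then obtain m where m: "z k = 2 * m" by (rule evenE)
        then have "1 \<le> m * m" using that by (intro sq) auto
        then show False using part[of "{k}"] m by simp
      qed
      show False
      proof (cases "\<exists>k. k \<noteq> j \<and> z k \<noteq> 0")
        case False
        obtain i where i: "i < 6" "odd (root_coeff i j)" using root_coeff_nonzero by blast
        have "ip z (root_coeff i) = (\<Sum>k\<in>{j}. z k * root_coeff i k)"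
          unfolding ip_def by (rule sum.mono_neutral_right) (use False in auto)
        then show False using z[OF i(1)] i(2) oddz[OF j] by simp
      next
        case True
        then obtain k where k: "k \<noteq> j" "z k \<noteq> 0" by blast
        have rest: "z l = 0" if "l \<noteq> j" "l \<noteq> k" for l
          using part[of "{j, k, l}"] that k sq[OF j] sq[OF k(2)] sq[of "z l"] by (cases "z l = 0") auto
        obtain i where i: "i < 6" "odd (root_coeff i j + root_coeff i k)" using root_coeff_separates k(1) by metis
        have "ip z (root_coeff i) = (\<Sum>l\<in>{j, k}. z l * root_coeff i l)"
          unfolding ip_def by (rule sum.mono_neutral_right) (use rest in auto)
        then have "ip z (root_coeff i) = z j * root_coeff i j + z k * root_coeff i k" using k(1) by simp
        then show False using z[OF i(1)] i(2) oddz[OF j] oddz[OF k(2)] by simp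
      qed
    qed
  qed
qed

section \<open>Words attaining the bounds\<close>

lemma ip_list:
  "(\<And>j. u j = U ! pos36 j) \<Longrightarrow> ip u (root_coeff i) = (\<Sum>n\<leftarrow>[0..<36]. U ! n * E6_roots ! n ! i)"
  "(\<And>j. u j = U ! pos36 j) \<Longrightarrow> ip u u = (\<Sum>n\<leftarrow>[0..<36]. U ! n * U ! n)"
  by (simp_all only: ip_def root_coeff_def sum_pos[of "\<lambda>n. U ! n * E6_roots ! n ! i"] sum_pos[of "\<lambda>n. U ! n * U ! n"])

text \<open>\<open>norm_12_word\<close> is twice the relation \<open>\<alpha>\<^sub>1 + \<alpha>\<^sub>3 = (\<alpha>\<^sub>1 + \<alpha>\<^sub>3)\<close>, with signs removed modulo \<open>4\<close>.
  \<open>norm_20_word\<close> is supported on the \<open>20\<close> positive roots of the \<open>D\<^sub>5\<close> without \<open>\<alpha>\<^sub>1\<close>, with signs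
  chosen such that the signed sum of these roots is \<open>0\<close> modulo \<open>4\<close>.\<close>

definition norm_12_word :: "int list" where
  "norm_12_word = [2,0,2,0,0,0,2] @ replicate 29 0"

definition norm_20_word :: "int list" where
  "norm_20_word = [0, 1, 1, 1, 1, 1, 0, 1, 1, 1, 1, 0, 1, 1, 1, 1, 0, 0, 1, 1, 1, 0, 0, -1, -1, 0, 0, -1,
    0, 0, 1, 0, 0, 0, 0, 0]"

lemma quaternary_code_norm_12: "\<exists>u\<in>quaternary_code. ip u u = 12"
proof -
  define u where "u j = norm_12_word ! pos36 j" for j
  have *: "\<forall>i\<in>set [0..<6]. 4 dvd (\<Sum>n\<leftarrow>[0..<36]. norm_12_word ! n * E6_roots ! n ! i)"
    "(\<Sum>n\<leftarrow>[0..<36]. norm_12_word ! n * norm_12_word ! n) = 12" "\<forall>n\<in>set [0..<36]. even (norm_12_word ! n)"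
    by code_simp+
  have "\<forall>i<6. 4 dvd ip u (root_coeff i)" unfolding ip_list(1)[OF u_def] using *(1) by simp
  moreover have "even (u j)" for j using *(3) pos_less[of j] by (simp add: u_def)
  ultimately have "u \<in> quaternary_code" unfolding quaternary_code_def by (auto intro!: exI[of _ "\<lambda>i. 0"])
  moreover have "ip u u = 12" unfolding ip_list(2)[OF u_def] by (rule *(2))
  ultimately show ?thesis by blast
qed

lemma shadow_words_norm_20: "\<exists>v\<in>shadow_words. ip v v = 20"
proof -
  define v where "v j = norm_20_word ! pos36 j" for j
  \<comment> \<open>Row \<open>0\<close> holds the coefficients of \<open>\<alpha>\<^sub>1\<close>,
    which are 0 or 1, so the word is odd exactly at the roots without
    \<open>\<alpha>\<^sub>1\<close>.\<close>
  have *: "\<forall>i\<in>set [0..<6]. 4 dvd (\<Sum>n\<leftarrow>[0..<36]. norm_20_word ! n * E6_roots ! n ! i)"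
    "(\<Sum>n\<leftarrow>[0..<36]. norm_20_word ! n * norm_20_word ! n) = 20"
    "\<forall>n\<in>set [0..<36]. even (norm_20_word ! n - 1 - E6_roots ! n ! 0)"
    by code_simp+
  have "\<forall>i<6. 4 dvd ip v (root_coeff i)" unfolding ip_list(1)[OF v_def] using *(1) by simp
  moreover have "even (v j - 1 - root_coeff 0 j)" for j using *(3) pos_less[of j] by (simp add: v_def root_coeff_def)
  ultimately have "v \<in> shadow_words" unfolding shadow_words_def
    using root_comb_single[of 0] by (auto intro!: exI[of _ "\<lambda>i. if i = 0 then 1 else 0"])
  moreover have "ip v v = 20" unfolding ip_list(2)[OF v_def] by (rule *(2))
  ultimately show ?thesis by blast
qed

section \<open>Construction A and the resulting lattice\<close>

definition half :: "(36 \<Rightarrow> int) \<Rightarrow> real ^ 36" where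
  "half u = (\<chi> j. of_int (u j) / 2)"

text \<open>Halving words divides inner products by 4, so divisibility by 4 in the code becomes
  integrality in the lattice.\<close>

lemma inner_half: "half u \<bullet> half v = of_int (ip u v) / 4"
  by (simp add: half_def inner_vec_def ip_def sum_divide_distrib)

lemma quarter_Ints: "(of_int m / 4 :: real) \<in> \<int> \<longleftrightarrow> 4 dvd m"
proof
  assume "(of_int m / 4 :: real) \<in> \<int>"
  then obtain k where "(of_int m / 4 :: real) = of_int k" by (elim Ints_cases)
  then have "real_of_int m = of_int (4 * k)" by (simp add: field_simps)
  then show "4 dvd m" unfolding of_int_eq_iff by simp
qed (auto elim!: dvdE)

lemma half_inj [simp]: "half u = half v \<longleftrightarrow> u = v"
  by (auto simp: half_def vec_eq_iff fun_eq_iff)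

text \<open>The test vectors are twice the unit vectors, so the hypothesis says that all coordinates
  of \<open>x\<close> are half-integers.\<close>

lemma half_coordinates:
  assumes "\<And>j. x \<bullet> half (\<lambda>k. 4 * unit_word j k) \<in> \<int>"
  obtains v where "x = half v"
proof -
  have "x \<bullet> half (\<lambda>k. 4 * unit_word j k) = 2 * x $ j" for j
    by (simp add: half_def inner_vec_def unit_word_def if_distrib if_distribR cong: if_cong)
  with assms have "2 * x $ j \<in> \<int>" for j by metis
  then have "2 * x $ j = of_int \<lfloor>2 * x $ j\<rfloor>" for j by (metis Ints_cases floor_of_int)
  then have "x = half (\<lambda>j. \<lfloor>2 * x $ j\<rfloor>)" by (simp add: half_def vec_eq_iff field_simps)
  then show ?thesis using that by blast
qed

text \<open>Half of this word is twice a unit vector, of norm 4. Pairing with these vectors confines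
  the duals of the lattice and of its even sublattice to halves of integral words.\<close>

lemma four_unit_word: "(\<lambda>k. 4 * unit_word j k) \<in> even_words"
proof -
  have "(\<lambda>k. 4 * unit_word j k) \<in> quaternary_code" using two_torsion_code[OF two_unit_torsion_code[of j]] by simp
  then show ?thesis by (simp add: even_words_def ip_linear)
qed

lemma unimodular_half_quaternary_code: "unimodular (half ` quaternary_code)"
proof -
  have dual: "half ` quaternary_code = dual_lattice (half ` quaternary_code)"
  proof
    show "half ` quaternary_code \<subseteq> dual_lattice (half ` quaternary_code)"
      by (auto simp: dual_lattice_def inner_half quarter_Ints quaternary_code_integral)
    show "dual_lattice (half ` quaternary_code) \<subseteq> half ` quaternary_code"
    proof
      fix x assume x: "x \<in> dual_lattice (half ` quaternary_code)"
      then have "x \<bullet> half (\<lambda>k. 4 * unit_word j k) \<in> \<int>" for j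
        using four_unit_word[of j] by (auto simp: dual_lattice_def even_words_def)
      then obtain v where v: "x = half v" by (rule half_coordinates)
      have "v \<in> quaternary_code" using x by (intro quaternary_code_dual) (auto simp: v dual_lattice_def inner_half quarter_Ints)
      then show "x \<in> half ` quaternary_code" using v by blast
    qed
  qed
  \<comment> \<open>The constant is 2 because the lattice contains twice every unit vector and has
    half-integral coordinates.\<close>
  have "full_lattice (half ` quaternary_code)"
  proof (rule full_lattice_commensurable[of _ 2])
    fix x y assume "x \<in> half ` quaternary_code" "y \<in> half ` quaternary_code"
    then obtain u v where uv: "x = half u" "y = half v" "u \<in> quaternary_code" "v \<in> quaternary_code" by blast
    have "x - y = half (\<lambda>j. u j - v j)" by (simp add: uv half_def vec_eq_iff diff_divide_distrib)
    then show "x - y \<in> half ` quaternary_code" using quaternary_code_diff[OF uv(3,4)] by blast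
  next
    fix b :: "real ^ 36" assume "b \<in> Basis"
    then obtain j where "b = axis j 1" by (auto simp: Basis_vec_def)
    then have "2 *\<^sub>R b = half (\<lambda>k. 4 * unit_word j k)"
      by (simp add: half_def vec_eq_iff unit_word_def axis_def)
    then show "2 *\<^sub>R b \<in> half ` quaternary_code" using four_unit_word[of j] by (auto simp: even_words_def)
  next
    fix x b :: "real ^ 36" assume "x \<in> half ` quaternary_code" "b \<in> Basis"
    then show "2 * (x \<bullet> b) \<in> \<int>" by (auto simp: Basis_vec_def inner_axis half_def)
  qed simp
  with dual show ?thesis by (simp add: unimodular_def)
qed

text \<open>The norm of \<open>half u\<close> is a quarter of \<open>ip u u\<close>, so it is even
  exactly when 8 divides \<open>ip u u\<close>.\<close>

lemma even_sublattice_half_quaternary_code: "even_sublattice (half ` quaternary_code) = half ` even_words"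
proof -
  have "(\<exists>k::int. half u \<bullet> half u = 2 * of_int k) \<longleftrightarrow> 8 dvd ip u u" for u
  proof -
    have "half u \<bullet> half u = 2 * of_int k \<longleftrightarrow> ip u u = 8 * k" for k
      unfolding inner_half by (simp add: field_simps) linarith
    then show ?thesis by (auto simp: dvd_def)
  qed
  then show ?thesis by (auto simp: even_sublattice_def even_words_def)
qed

text \<open>By \<open>even_words_dual\<close> the dual of the even sublattice consists of two
  classes, which are disjoint; removing the lattice leaves the shadow words.\<close>

lemma shadow_half_quaternary_code: "shadow (half ` quaternary_code) = half ` shadow_words"
proof
  show "half ` shadow_words \<subseteq> shadow (half ` quaternary_code)"
    unfolding shadow_def even_sublattice_half_quaternary_code
    using shadow_words_not_quaternary_code by (auto simp: dual_lattice_def inner_half quarter_Ints shadow_words_integral)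
  show "shadow (half ` quaternary_code) \<subseteq> half ` shadow_words"
  proof
    fix x assume "x \<in> shadow (half ` quaternary_code)"
    then have x: "x \<in> dual_lattice (half ` even_words)" "x \<notin> half ` quaternary_code"
      by (auto simp: shadow_def even_sublattice_half_quaternary_code)
    then have "x \<bullet> half (\<lambda>k. 4 * unit_word j k) \<in> \<int>" for j
      using four_unit_word[of j] by (auto simp: dual_lattice_def)
    then obtain v where v: "x = half v" by (rule half_coordinates)
    have "v \<in> quaternary_code \<or> v \<in> shadow_words" using x(1)
      by (intro even_words_dual) (auto simp: v dual_lattice_def inner_half quarter_Ints)
    then show "x \<in> half ` shadow_words" using v x(2) by blast
  qed
qed

text \<open>A lower bound alone does not determine \<open>least_norm\<close>; the explicit words of
  norms 12 and 20 show that the minima are attained.\<close>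

lemma least_norm_half:
  assumes "u \<in> A" "\<And>v. v \<in> A \<Longrightarrow> ip u u \<le> ip v v"
  shows "least_norm (half ` A) = of_int (ip u u) / 4"
  unfolding least_norm_def
  by (rule Least_equality) (use assms in \<open>auto simp: inner_half\<close>)

theorem proposition3p3:
  shows "\<exists>L :: (real ^ 36) set. unimodular L \<and> min_norm L = 3 \<and> shadow_sigma L = 20"
proof (intro exI conjI)
  show "unimodular (half ` quaternary_code)" by (rule unimodular_half_quaternary_code)
  obtain u where u: "u \<in> quaternary_code" "ip u u = 12" using quaternary_code_norm_12 by blast
  have "half (\<lambda>j. 0) = 0" by (simp add: half_def vec_eq_iff)
  then have "half ` quaternary_code - {0} = half ` (quaternary_code - {\<lambda>j. 0})" by (auto simp flip: half_inj)
  moreover have "u \<noteq> (\<lambda>j. 0)" using u(2) by (auto simp: ip_def)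
  ultimately show "min_norm (half ` quaternary_code) = 3"
    using u quaternary_code_norm least_norm_half[of u "quaternary_code - {\<lambda>j. 0}"] by (simp add: min_norm_def)
  \<comment> \<open>The factor 4 in \<open>shadow_sigma\<close> cancels the quarter from halving, so
    the value is the least norm of a shadow word.\<close>
  obtain v where v: "v \<in> shadow_words" "ip v v = 20" using shadow_words_norm_20 by blast
  then show "shadow_sigma (half ` quaternary_code) = 20"
    using shadow_words_norm least_norm_half[of v shadow_words] by (simp add: shadow_sigma_def shadow_half_quaternary_code)
qed

end
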